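(* Fix $q>0$, $k\ge1$ and $\sigma\in\mathfrak{S}_k$, and let $\pi\sim\mathrm{Maj}(n,q)$ with $n\ge k$. Let $T_\sigma(\pi)$ be the number of occurrences of $\sigma$ in $\pi$. Then (i) $\mathbb{E}[T_\sigma(\pi)]=\binom{n}{k}\frac{q^{\mathrm{maj}(\sigma)}}{[k]_q!}=\Theta(n^k)$ as $n\to\infty$; (ii) $\mathrm{Var}(T_\sigma(\pi))=O(n^{2k-1})$ as $n\to\infty$.
   Context: $\mathrm{Maj}(n,q)$ is the distribution on $\mathfrak{S}_n$ with $\mathbb{P}(\mathrm{Maj}(n,q)=\pi)=q^{\mathrm{maj}(\pi)}/[n]_q!$, where $\mathrm{maj}(\pi)=\sum_{i:\pi(i)>\pi(i+1)} i$, $[m]_q=1+q+\dots+q^{m-1}$, $[n]_q!=\prod_{m=1}^n[m]_q$. A $k$-tuple of indices $i_1<\dots<i_k$ is an occurrence of $\sigma\in\mathfrak{S}_k$ in $\pi$ if $(\pi(i_1),\dots,\pi(i_k))$ is order-isomorphic to $\sigma$; $T_\sigma(\pi)$ is the number of such tuples. *)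

theory Defs
  imports
    "HOL-Probability.Probability"
    "HOL-Combinatorics.Permutations"
    "HOL-Library.Landau_Symbols"
begin

text \<open>
  The symmetric group of degree \<open>n\<close> is the set of functions \<open>\<pi> :: nat \<Rightarrow> nat\<close> with
  \<open>\<pi> permutes {1..n}\<close>; such a \<open>\<pi>\<close> is the identity outside \<open>{1..n}\<close>.
\<close>

definition maj :: "nat \<Rightarrow> (nat \<Rightarrow> nat) \<Rightarrow> nat" where
  "maj n \<pi> = (\<Sum>i \<in> {i \<in> {1..<n}. \<pi> i > \<pi> (i + 1)}. i)"

definition q_number :: "real \<Rightarrow> nat \<Rightarrow> real" where
  "q_number q m = (\<Sum>i<m. q ^ i)"

definition q_fact :: "real \<Rightarrow> nat \<Rightarrow> real" where
  "q_fact q n = (\<Prod>m=1..n. q_number q m)"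

text \<open>
  The distribution \<open>Maj(n,q)\<close>: the measure on the permutations of \<open>{1..n}\<close>, all sets being
  measurable, that gives each \<open>\<pi>\<close> the mass \<open>q ^ maj n \<pi> / q_fact q n\<close>. For \<open>q > 0\<close> these
  masses are positive, and they add up to 1 by MacMahon's theorem.
\<close>

definition Maj :: "nat \<Rightarrow> real \<Rightarrow> (nat \<Rightarrow> nat) measure" where
  "Maj n q = point_measure {\<pi>. \<pi> permutes {1..n}} (\<lambda>\<pi>. ennreal (q ^ maj n \<pi> / q_fact q n))"

text \<open>
  The tuple of indices \<open>(i\<^sub>1, \<dots>, i\<^sub>k)\<close> is the function \<open>\<iota>\<close> on \<open>{1..k}\<close>, made
  \<^term>\<open>undefined\<close> elsewhere by \<^term>\<open>PiE\<close> so that distinct functions are distinct tuples.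
\<close>

definition occurrences :: "nat \<Rightarrow> (nat \<Rightarrow> nat) \<Rightarrow> nat \<Rightarrow> (nat \<Rightarrow> nat) \<Rightarrow> (nat \<Rightarrow> nat) set" where
  "occurrences k \<sigma> n \<pi> =
     {\<iota> \<in> {1..k} \<rightarrow>\<^sub>E {1..n}. strict_mono_on {1..k} \<iota> \<and>
        (\<forall>a\<in>{1..k}. \<forall>b\<in>{1..k}. \<pi> (\<iota> a) < \<pi> (\<iota> b) \<longleftrightarrow> \<sigma> a < \<sigma> b)}"

definition pattern_count :: "nat \<Rightarrow> (nat \<Rightarrow> nat) \<Rightarrow> nat \<Rightarrow> (nat \<Rightarrow> nat) \<Rightarrow> nat" where
  "pattern_count k \<sigma> n \<pi> = card (occurrences k \<sigma> n \<pi>)"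

end

theory Submission
  imports Defs "HOL-Combinatorics.Multiset_Permutations"
begin

text \<open>
  Index the occurrences of \<open>\<sigma>\<close> by their set \<open>A\<close> of values instead of their positions:
  \<open>T\<^sub>\<sigma>(\<pi>)\<close> counts the \<open>k\<close>-sets \<open>A\<close> such that the subword of \<open>\<pi>\<close> on the letters in \<open>A\<close> is the
  rearrangement of \<open>A\<close> with pattern \<open>\<sigma>\<close>. By the theorem of Garsia and Gessel, the shuffles of two
  words with disjoint letters have the generating function
  \<open>q ^ (maj u + maj v)\<close> times the Gaussian binomial coefficient. Hence each \<open>A\<close>
  occurs with probability \<open>q ^ maj \<sigma> / [k]\<^sub>q!\<close>, and the events for disjoint \<open>A\<close> and \<open>B\<close> are
  independent. Only the at most \<open>n ^ (2 * k - 1)\<close> pairs of intersecting sets contribute to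
  the variance.
\<close>

text \<open>
  The major index of the reversed word. Reversal puts the last letter of a word at the head of
  the list, so that recursion on lists removes letters from the end of the word.
\<close>

fun rmaj :: "'a::linorder list \<Rightarrow> nat" where
  "rmaj [] = 0"
| "rmaj [x] = 0"
| "rmaj (x # y # w) = (if x < y then Suc (length w) else 0) + rmaj (y # w)"

section \<open>q-factorials and Gaussian binomial coefficients\<close>

definition gauss_binomial :: "real \<Rightarrow> nat \<Rightarrow> nat \<Rightarrow> real" where
  "gauss_binomial q a b = q_fact q (a + b) / (q_fact q a * q_fact q b)"

lemma q_number_add: "q_number q (a + b) = q_number q a + q ^ a * q_number q b"
  by (induction b) (simp_all add: q_number_def algebra_simps power_add)

lemma q_number_pos: "0 < q \<Longrightarrow> 0 < m \<Longrightarrow> 0 < q_number q m"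
  unfolding q_number_def by (rule sum_pos) auto

lemma q_fact_0 [simp]: "q_fact q 0 = 1"
  by (simp add: q_fact_def)

lemma q_fact_Suc: "q_fact q (Suc n) = q_number q (Suc n) * q_fact q n"
  by (simp add: q_fact_def mult.commute)

lemma q_fact_pos: "0 < q \<Longrightarrow> 0 < q_fact q n"
  by (induction n) (auto simp: q_fact_Suc intro!: mult_pos_pos q_number_pos)

lemma gauss_binomial_0 [simp]:
  assumes "0 < q"
  shows "gauss_binomial q 0 b = 1" "gauss_binomial q a 0 = 1"
  using q_fact_pos[OF assms, of a] q_fact_pos[OF assms, of b]
  by (simp_all add: gauss_binomial_def)

lemma gauss_binomial_commute: "gauss_binomial q a b = gauss_binomial q b a"
  by (simp add: gauss_binomial_def add.commute mult.commute)

text \<open>In the top factor of the numerator, [a+b+2] splits as [a+1] + q^(a+1) [b+1]; each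
  summand cancels one factor of the denominator. This form adds up the contributions of the two
  possible last letters of a shuffle.\<close>

lemma gauss_binomial_pascal:
  assumes "0 < q"
  shows "gauss_binomial q (Suc a) (Suc b) =
    gauss_binomial q a (Suc b) + q ^ Suc a * gauss_binomial q (Suc a) b"
proof -
  define F where "F = q_fact q (a + Suc b)"
  define A where "A = q_fact q a"
  define B where "B = q_fact q b"
  define m where "m = q_number q (Suc a)"
  define l where "l = q_number q (Suc b)"
  have pos: "0 < A" "0 < B" "0 < m" "0 < l"
    using assms by (auto simp: A_def B_def m_def l_def intro: q_fact_pos q_number_pos)
  have "gauss_binomial q (Suc a) (Suc b) = (m + q ^ Suc a * l) * F / (m * A * (l * B))"
    using q_number_add[of q "Suc a" "Suc b"]
    by (simp add: gauss_binomial_def q_fact_Suc F_def A_def B_def m_def l_def)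
  moreover have "gauss_binomial q a (Suc b) = F / (A * (l * B))"
    by (simp add: gauss_binomial_def q_fact_Suc F_def A_def B_def l_def)
  moreover have "gauss_binomial q (Suc a) b = F / (m * A * B)"
    by (simp add: gauss_binomial_def q_fact_Suc F_def A_def B_def m_def)
  moreover have "(m + q ^ Suc a * l) * F / (m * A * (l * B)) = F / (A * (l * B)) + q ^ Suc a * (F / (m * A * B))"
    using pos by (simp add: field_simps)
  ultimately show ?thesis
    by simp
qed

text \<open>The mirror image under exchanging \<open>a\<close> and \<open>b\<close>. It serves the
  refined induction on shuffles, where a new descent puts the extra power of \<open>q\<close> on the
  first summand.\<close>

lemma gauss_binomial_pascal':
  assumes "0 < q"
  shows "gauss_binomial q (Suc a) (Suc b) =
    q ^ Suc b * gauss_binomial q a (Suc b) + gauss_binomial q (Suc a) b"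
  using gauss_binomial_pascal[OF assms, of b a] by (simp add: gauss_binomial_commute)

section \<open>The generating function of shuffles (Garsia and Gessel)\<close>

lemma sum_shuffles_Cons:
  assumes "x \<noteq> y"
  shows "(\<Sum>w\<in>shuffles (x # u) (y # v). f w) =
    (\<Sum>w\<in>shuffles u (y # v). f (x # w)) + (\<Sum>w\<in>shuffles (x # u) v. f (y # w))"
proof -
  have "(\<Sum>w\<in>shuffles (x # u) (y # v). f w) =
      sum f ((#) x ` shuffles u (y # v)) + sum f ((#) y ` shuffles (x # u) v)"
    using assms by (auto intro: sum.union_disjoint)
  then show ?thesis
    by (simp add: sum.reindex)
qed

lemma rmaj_Cons_no_descent: "\<not> x < hd w \<Longrightarrow> rmaj (x # w) = rmaj w"
  by (cases w) auto

lemma rmaj_Cons_descent: "w \<noteq> [] \<Longrightarrow> x < hd w \<Longrightarrow> rmaj (x # w) = length w + rmaj w"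
  by (cases w) auto

lemma hd_shuffles:
  assumes "w \<in> shuffles (x # u) (y # v)"
  shows "w \<noteq> []" "hd w = x \<or> hd w = y"
  using assms by auto

text \<open>The value of \<open>rmaj (x # w)\<close> depends on the head of \<open>w\<close>, so the
  induction has to keep track of heads: \<open>top\<close> concerns the shuffles of
  \<open>x # u\<close> and \<open>y # v\<close> that start with \<open>x\<close>, and
  \<open>bot\<close> those that start with \<open>y\<close>. An inner induction proves both from the
  unrefined identity \<open>full\<close> for shorter words; an outer induction on the total length
  then gives \<open>full\<close>.\<close>

lemma sum_rmaj_shuffles:
  fixes u v :: "'a::linorder list"
  assumes q: "0 < q" and "set u \<inter> set v = {}"
  shows "(\<Sum>w\<in>shuffles u v. q ^ rmaj w) =
    q ^ (rmaj u + rmaj v) * gauss_binomial q (length u) (length v)"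
  using assms(2)
proof -
  define full where "full u v \<longleftrightarrow> (\<Sum>w\<in>shuffles u v. q ^ rmaj w) =
    q ^ (rmaj u + rmaj v) * gauss_binomial q (length u) (length v)" for u v :: "'a list"
  define top where "top x u y v \<longleftrightarrow> (\<Sum>w\<in>shuffles u (y # v). q ^ rmaj (x # w)) =
    q ^ (rmaj (x # u) + rmaj (y # v)) * gauss_binomial q (length u) (Suc (length v))" for x y :: 'a and u v
  define bot where "bot x u y v \<longleftrightarrow> (\<Sum>w\<in>shuffles (x # u) v. q ^ rmaj (y # w)) =
    q ^ (rmaj (x # u) + rmaj (y # v)) * (q ^ Suc (length u) * gauss_binomial q (Suc (length u)) (length v))"
    for x y :: 'a and u v
  have full_commute: "full u v \<longleftrightarrow> full v u" for u v
    by (simp add: full_def shuffles_commutes[of u v] gauss_binomial_commute[of q "length u"] add.commute)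
  \<comment> \<open>When the last letters \<open>x > y\<close> of the two words are compared, the shuffles ending in \<open>x\<close> and
    those ending in \<open>y\<close> contribute exactly the two terms of Pascal's rule.\<close>
  have step: "top x u y v \<and> bot x u y v"
    if less: "y < x" and disj: "set (x # u) \<inter> set (y # v) = {}"
      and full: "\<And>u' v'. length u' + length v' \<le> Suc (length u + length v) \<Longrightarrow> set u' \<inter> set v' = {} \<Longrightarrow> full u' v'"
    for x y :: 'a and u v
    using that
  proof (induction "length u + length v" arbitrary: x u y v rule: less_induct)
    case less
    note yx = less.prems(1) and disj = less.prems(2) and full = less.prems(3)
    have IH: "top x' u' y' v' \<and> bot x' u' y' v'"
      if "y' < x'" "set (x' # u') \<inter> set (y' # v') = {}" "length u' + length v' < length u + length v" for x' u' y' v'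
      using less.hyps[of u' v' y' x'] that less.prems(3) by auto
    have "top x u y v"
    proof (cases u)
      case Nil
      then show ?thesis using yx q by (auto simp: top_def)
    next
      case (Cons x' u')
      show ?thesis
      proof (cases "x < x'")
        \<comment> \<open>Here \<open>x\<close> is at least \<open>x'\<close> and exceeds
          \<open>y\<close>, so prefixing it never creates a descent: the sum is the unrefined one
          for \<open>u\<close> and \<open>y # v\<close>.\<close>
        case False
        have "rmaj (x # w) = rmaj w" if "w \<in> shuffles u (y # v)" for w
          using hd_shuffles[OF that[unfolded Cons]] False yx by (intro rmaj_Cons_no_descent) auto
        then have "(\<Sum>w\<in>shuffles u (y # v). q ^ rmaj (x # w)) = (\<Sum>w\<in>shuffles u (y # v). q ^ rmaj w)"
          by (intro sum.cong) auto
        then show ?thesis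
          using full[of u "y # v"] disj Cons False by (auto simp: full_def top_def)
      next
        \<comment> \<open>Now \<open>y < x < x'\<close>: prefixing \<open>x\<close> creates a
          descent exactly for the shuffles that start with \<open>x'\<close>. The induction
          hypothesis for the letters \<open>x'\<close> and \<open>y\<close> evaluates both halves,
          and Pascal's rule recombines them.\<close>
        case True
        then have yx': "y < x'" using yx by auto
        have IH': "top x' u' y v" "bot x' u' y v"
          using IH[OF yx', of u' v] disj Cons by auto
        have 1: "(\<Sum>w\<in>shuffles u' (y # v). q ^ rmaj (x # x' # w)) =
            q ^ (length u + Suc (length v)) * (\<Sum>w\<in>shuffles u' (y # v). q ^ rmaj (x' # w))"
          unfolding sum_distrib_left
          by (intro sum.cong refl) (use True Cons in \<open>auto simp: length_shuffles power_add\<close>)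
        have 2: "(\<Sum>w\<in>shuffles (x' # u') v. q ^ rmaj (x # y # w)) = (\<Sum>w\<in>shuffles (x' # u') v. q ^ rmaj (y # w))"
          using yx by (intro sum.cong) auto
        have "x' \<noteq> y" using yx' by simp
        then have "(\<Sum>w\<in>shuffles u (y # v). q ^ rmaj (x # w)) =
           q ^ (length u + Suc (length v)) * (\<Sum>w\<in>shuffles u' (y # v). q ^ rmaj (x' # w)) +
           (\<Sum>w\<in>shuffles (x' # u') v. q ^ rmaj (y # w))"
          unfolding Cons sum_shuffles_Cons[OF \<open>x' \<noteq> y\<close>] using 1 2 Cons by (simp del: rmaj.simps)
        moreover have "rmaj (x # u) = length u + rmaj (x' # u')"
          using Cons True by simp
        ultimately show ?thesis
          using IH' gauss_binomial_pascal'[OF q, of "length u'" "length v"] Cons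
          unfolding top_def bot_def by (simp add: power_add algebra_simps del: rmaj.simps)
      qed
    qed
    moreover have "bot x u y v"
    proof (cases v)
      case Nil
      then show ?thesis using yx q by (auto simp: bot_def power_add)
    next
      case (Cons y' v')
      show ?thesis
      proof (cases "y < y'")
        \<comment> \<open>Here \<open>y\<close> is below both possible heads, so prefixing it always
          creates a descent; what remains is the unrefined sum for \<open>x # u\<close> and
          \<open>v\<close>.\<close>
        case True
        have "rmaj (y # w) = length w + rmaj w" if "w \<in> shuffles (x # u) v" for w
          using hd_shuffles[OF that[unfolded Cons]] True yx by (intro rmaj_Cons_descent) auto
        then have "(\<Sum>w\<in>shuffles (x # u) v. q ^ rmaj (y # w)) =
            q ^ (Suc (length u + length v)) * (\<Sum>w\<in>shuffles (x # u) v. q ^ rmaj w)"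
          unfolding sum_distrib_left
          by (intro sum.cong) (auto simp: length_shuffles power_add)
        then show ?thesis
          using full[of "x # u" v] disj Cons True by (auto simp: full_def bot_def power_add algebra_simps)
      next
        \<comment> \<open>Now \<open>y' \<le> y < x\<close>: a descent is created exactly for the
          shuffles that start with \<open>x\<close>, and the induction hypothesis for
          \<open>x\<close> and \<open>y'\<close> evaluates both halves.\<close>
        case False
        then have yx': "y' < x" using yx by auto
        have IH': "top x u y' v'" "bot x u y' v'"
          using IH[OF yx', of u v'] disj Cons by auto
        have 1: "(\<Sum>w\<in>shuffles u (y' # v'). q ^ rmaj (y # x # w)) =
            q ^ (Suc (length u + length v)) * (\<Sum>w\<in>shuffles u (y' # v'). q ^ rmaj (x # w))"
          unfolding sum_distrib_left
          by (intro sum.cong refl) (use yx Cons in \<open>auto simp: length_shuffles power_add\<close>)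
        have 2: "(\<Sum>w\<in>shuffles (x # u) v'. q ^ rmaj (y # y' # w)) = (\<Sum>w\<in>shuffles (x # u) v'. q ^ rmaj (y' # w))"
          using False by simp
        have "x \<noteq> y'" using yx' by simp
        then have "(\<Sum>w\<in>shuffles (x # u) v. q ^ rmaj (y # w)) =
           q ^ (Suc (length u + length v)) * (\<Sum>w\<in>shuffles u (y' # v'). q ^ rmaj (x # w)) +
           (\<Sum>w\<in>shuffles (x # u) v'. q ^ rmaj (y' # w))"
          unfolding Cons sum_shuffles_Cons[OF \<open>x \<noteq> y'\<close>] using 1 2 Cons by (simp del: rmaj.simps)
        moreover have "rmaj (y # v) = rmaj (y' # v')"
          using Cons False by simp
        ultimately show ?thesis
          using IH' gauss_binomial_pascal'[OF q, of "length u" "length v'"] Cons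
          unfolding top_def bot_def by (simp add: power_add algebra_simps del: rmaj.simps)
      qed
    qed
    ultimately show ?case ..
  qed
  have "full u v" if "set u \<inter> set v = {}" for u v
    using that
  proof (induction "length u + length v" arbitrary: u v rule: less_induct)
    case less
    have Cons_case: "full (x # u') (y # v')"
      if "y < x" "set (x # u') \<inter> set (y # v') = {}" "length (x # u') + length (y # v') \<le> length u + length v" for x y u' v'
    proof -
      \<comment> \<open>The lengths for which \<open>step\<close> asks for \<open>full\<close> stop
        one short of the total length of \<open>x # u'\<close> and \<open>y # v'\<close>, so the
        outer induction hypothesis supplies them.\<close>
      have "top x u' y v' \<and> bot x u' y v'"
        by (rule step) (use that less.hyps in auto)
      moreover have "x \<noteq> y" using that by simp
      ultimately show ?thesis
        using gauss_binomial_pascal[OF q, of "length u'" "length v'"]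
        unfolding full_def top_def bot_def sum_shuffles_Cons[OF \<open>x \<noteq> y\<close>]
        by (simp add: algebra_simps del: rmaj.simps)
    qed
    show ?case
    proof (cases "u = [] \<or> v = []")
      case True
      then show ?thesis using q by (auto simp: full_def)
    next
      case False
      then obtain x u' y v' where uv: "u = x # u'" "v = y # v'"
        by (meson list.exhaust)
      then have "x \<noteq> y" using less.prems by auto
      then consider "y < x" | "x < y" by fastforce
      then show ?thesis
      proof cases
        case 1
        then show ?thesis using Cons_case[of y x u' v'] less.prems uv by auto
      next
        \<comment> \<open>The argument so far wants the smaller head in the second word; here the
          words are exchanged, which alters neither side of the identity.\<close>
        case 2
        then show ?thesis
          using Cons_case[of x y v' u'] less.prems uv full_commute[of u v] by auto
      qed
    qed
  qed
  then show ?thesis using assms(2) unfolding full_def by blast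
qed

section \<open>Arrangements with prescribed subwords\<close>

text \<open>Such a word is a shuffle of \<open>u\<close> with its subword \<open>v\<close> on
  \<open>C - A\<close>. Since the word determines \<open>v\<close>, the sets
  \<open>shuffles u v\<close> partition the range of summation.\<close>

lemma sum_permutations_of_set_filter:
  assumes "A \<subseteq> C" and u: "u \<in> permutations_of_set A"
  shows "(\<Sum>w | w \<in> permutations_of_set C \<and> filter (\<lambda>x. x \<in> A) w = u. f w) =
    (\<Sum>v\<in>permutations_of_set (C - A). \<Sum>w\<in>shuffles u v. f w)"
proof -
  have set_u: "set u = A" and dist_u: "distinct u"
    using u by (auto dest: permutations_of_setD)
  have "{w \<in> permutations_of_set C. filter (\<lambda>x. x \<in> A) w = u} =
      (\<Union>v\<in>permutations_of_set (C - A). shuffles u v)"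
  proof (intro equalityI subsetI)
    fix w assume w: "w \<in> {w \<in> permutations_of_set C. filter (\<lambda>x. x \<in> A) w = u}"
    then have "filter (\<lambda>x. x \<notin> A) w \<in> permutations_of_set (C - A)"
      by (auto simp: permutations_of_set_def)
    moreover have "w \<in> shuffles u (filter (\<lambda>x. x \<notin> A) w)"
      using w partition_in_shuffles[of w "\<lambda>x. x \<in> A"] by auto
    ultimately show "w \<in> (\<Union>v\<in>permutations_of_set (C - A). shuffles u v)"
      by blast
  next
    fix w assume "w \<in> (\<Union>v\<in>permutations_of_set (C - A). shuffles u v)"
    then obtain v where v: "v \<in> permutations_of_set (C - A)" "w \<in> shuffles u v"
      by blast
    have disj: "set u \<inter> set v = {}" and "distinct v" "set v = C - A"
      using v(1) set_u by (auto simp: permutations_of_set_def)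
    then have "distinct w" "set w = C"
      using distinct_disjoint_shuffles[OF dist_u _ disj v(2)] set_shuffles[OF v(2)] set_u assms(1)
      by auto
    then show "w \<in> {w \<in> permutations_of_set C. filter (\<lambda>x. x \<in> A) w = u}"
      using filter_shuffles_disjoint1(1)[OF disj v(2)] set_u by auto
  qed
  moreover have "shuffles u v \<inter> shuffles u v' = {}"
    if "v \<in> permutations_of_set (C - A)" "v' \<in> permutations_of_set (C - A)" "v \<noteq> v'" for v v'
  proof -
    have "set u \<inter> set v = {}" "set u \<inter> set v' = {}"
      using that set_u by (auto simp: permutations_of_set_def)
    then show ?thesis
      using filter_shuffles_disjoint1(2)[of u v] filter_shuffles_disjoint1(2)[of u v'] that(3)
      by fastforce
  qed
  ultimately show ?thesis
    by (simp add: sum.UNION_disjoint)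
qed

lemma length_permutations_of_set: "w \<in> permutations_of_set A \<Longrightarrow> length w = card A"
  by (auto simp: permutations_of_set_def distinct_card[symmetric])

text \<open>MacMahon's theorem, one letter at a time: inserting \<open>x\<close> into
  \<open>v\<close> in all ways is shuffling \<open>v\<close> with \<open>[x]\<close>, and the
  Gaussian binomial for 1 and m is [m+1].\<close>

lemma sum_rmaj_permutations_of_set:
  fixes C :: "'a::linorder set"
  assumes q: "0 < q" and "finite C"
  shows "(\<Sum>w\<in>permutations_of_set C. q ^ rmaj w) = q_fact q (card C)"
  using assms(2)
proof (induction C)
  case empty
  then show ?case by simp
next
  case (insert x C)
  \<comment> \<open>The subword on \<open>{x}\<close> is always \<open>[x]\<close>, so the
    decomposition into shuffles covers all words.\<close>
  have "filter (\<lambda>y. y \<in> {x}) w = [x]" if "w \<in> permutations_of_set (insert x C)" for w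
  proof -
    have "set (filter (\<lambda>y. y \<in> {x}) w) = {x}" "distinct (filter (\<lambda>y. y \<in> {x}) w)"
      using that by (auto simp: permutations_of_set_def)
    then have "filter (\<lambda>y. y \<in> {x}) w \<in> permutations_of_set {x}"
      by blast
    then show ?thesis by simp
  qed
  then have "{w. w \<in> permutations_of_set (insert x C) \<and> filter (\<lambda>y. y \<in> {x}) w = [x]} = permutations_of_set (insert x C)"
    by blast
  then have "(\<Sum>w\<in>permutations_of_set (insert x C). q ^ rmaj w) =
      (\<Sum>v\<in>permutations_of_set C. \<Sum>w\<in>shuffles [x] v. q ^ rmaj w)"
    using sum_permutations_of_set_filter[of "{x}" "insert x C" "[x]" "\<lambda>w. q ^ rmaj w"] insert.hyps
    by simp
  also have "\<dots> = (\<Sum>v\<in>permutations_of_set C. q ^ rmaj v * gauss_binomial q 1 (card C))"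
  proof (intro sum.cong refl)
    fix v assume v: "v \<in> permutations_of_set C"
    then have "set [x] \<inter> set v = {}"
      using insert.hyps by (auto simp: permutations_of_set_def)
    then show "(\<Sum>w\<in>shuffles [x] v. q ^ rmaj w) = q ^ rmaj v * gauss_binomial q 1 (card C)"
      using sum_rmaj_shuffles[OF q, of "[x]" v] length_permutations_of_set[OF v] by simp
  qed
  also have "\<dots> = q_fact q (card C) * gauss_binomial q 1 (card C)"
    using insert.IH by (simp flip: sum_distrib_right)
  also have "\<dots> = q_fact q (card (insert x C))"
    using insert.hyps q_fact_pos[OF q, of "card C"]
    by (simp add: gauss_binomial_def q_fact_Suc[of q 0] q_number_def)
  finally show ?case .
qed

text \<open>Divided by \<open>q_fact q (card C)\<close>, this is the probability that the subword on
  \<open>A\<close> is \<open>u\<close>. MacMahon's theorem sums out the subword on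
  \<open>C - A\<close>, and its q-factorial cancels in the Gaussian binomial.\<close>

lemma sum_rmaj_filter:
  fixes A C :: "'a::linorder set"
  assumes q: "0 < q" and "finite C" "A \<subseteq> C" and u: "u \<in> permutations_of_set A"
  shows "(\<Sum>w | w \<in> permutations_of_set C \<and> filter (\<lambda>x. x \<in> A) w = u. q ^ rmaj w) =
    q ^ rmaj u * q_fact q (card C) / q_fact q (card A)"
proof -
  have finA: "finite A"
    using assms(2,3) by (rule rev_finite_subset)
  have card_C: "card A + card (C - A) = card C"
    using assms by (metis card_Diff_subset card_mono finA le_add_diff_inverse)
  have "(\<Sum>w | w \<in> permutations_of_set C \<and> filter (\<lambda>x. x \<in> A) w = u. q ^ rmaj w) =
      (\<Sum>v\<in>permutations_of_set (C - A). q ^ rmaj v * (q ^ rmaj u * gauss_binomial q (card A) (card (C - A))))"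
    unfolding sum_permutations_of_set_filter[OF assms(3) u]
  proof (intro sum.cong refl)
    fix v assume v: "v \<in> permutations_of_set (C - A)"
    then have "set u \<inter> set v = {}"
      using u by (auto simp: permutations_of_set_def)
    then show "(\<Sum>w\<in>shuffles u v. q ^ rmaj w) =
        q ^ rmaj v * (q ^ rmaj u * gauss_binomial q (card A) (card (C - A)))"
      using sum_rmaj_shuffles[OF q, of u v] length_permutations_of_set[OF v] length_permutations_of_set[OF u]
      by (simp add: power_add mult_ac)
  qed
  also have "\<dots> = q_fact q (card (C - A)) * (q ^ rmaj u * gauss_binomial q (card A) (card (C - A)))"
    using assms(2) sum_rmaj_permutations_of_set[OF q, of "C - A"] by (simp flip: sum_distrib_right)
  also have "\<dots> = q ^ rmaj u * q_fact q (card C) / q_fact q (card A)"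
    using card_C q_fact_pos[OF q, of "card (C - A)"] by (simp add: gauss_binomial_def)
  finally show ?thesis .
qed

text \<open>This makes the subwords on disjoint sets independent. The words are grouped by their
  subword on \<open>A \<union> B\<close>, which ranges over the shuffles of \<open>u\<close> and
  \<open>v\<close>; \<open>sum_rmaj_filter\<close> evaluates each group and the shuffle theorem sums
  the results.\<close>

lemma sum_rmaj_filter_disjoint:
  fixes A B C :: "'a::linorder set"
  assumes q: "0 < q" and "finite C" "A \<subseteq> C" "B \<subseteq> C" and disj: "A \<inter> B = {}"
    and u: "u \<in> permutations_of_set A" and v: "v \<in> permutations_of_set B"
  shows "(\<Sum>w | w \<in> permutations_of_set C \<and> filter (\<lambda>x. x \<in> A) w = u \<and> filter (\<lambda>x. x \<in> B) w = v. q ^ rmaj w) =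
    q ^ rmaj u * q ^ rmaj v * q_fact q (card C) / (q_fact q (card A) * q_fact q (card B))"
proof -
  have sets: "set u = A" "set v = B" "distinct u" "distinct v"
    using u v by (auto dest: permutations_of_setD)
  have fin: "finite A" "finite B"
    using sets by auto
  have sh: "w \<in> permutations_of_set (A \<union> B)" if "w \<in> shuffles u v" for w
    using that sets disj set_shuffles[OF that] distinct_disjoint_shuffles[of u v w] by auto
  have "{w. w \<in> permutations_of_set C \<and> filter (\<lambda>x. x \<in> A) w = u \<and> filter (\<lambda>x. x \<in> B) w = v} =
      (\<Union>s\<in>shuffles u v. {w. w \<in> permutations_of_set C \<and> filter (\<lambda>x. x \<in> A \<union> B) w = s})"
  proof (intro equalityI subsetI)
    fix w assume w: "w \<in> {w. w \<in> permutations_of_set C \<and> filter (\<lambda>x. x \<in> A) w = u \<and> filter (\<lambda>x. x \<in> B) w = v}"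
    let ?s = "filter (\<lambda>x. x \<in> A \<union> B) w"
    have "filter (\<lambda>x. x \<in> A) ?s = u"
      using w by (auto simp: conj_disj_distribL cong: conj_cong intro!: arg_cong[where f = "\<lambda>P. filter P w"])
    moreover have "filter (\<lambda>x. x \<notin> A) ?s = v"
    proof -
      have "filter (\<lambda>x. x \<notin> A) ?s = filter (\<lambda>x. x \<in> B) w"
        using disj by (auto intro!: filter_cong)
      then show ?thesis using w by simp
    qed
    ultimately have "?s \<in> shuffles u v"
      using partition_in_shuffles[of ?s "\<lambda>x. x \<in> A"] by simp
    then show "w \<in> (\<Union>s\<in>shuffles u v. {w. w \<in> permutations_of_set C \<and> filter (\<lambda>x. x \<in> A \<union> B) w = s})"
      using w by blast
  next
    fix w assume "w \<in> (\<Union>s\<in>shuffles u v. {w. w \<in> permutations_of_set C \<and> filter (\<lambda>x. x \<in> A \<union> B) w = s})"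
    then have w: "w \<in> permutations_of_set C" and s: "filter (\<lambda>x. x \<in> A \<union> B) w \<in> shuffles u v" (is "?s \<in> _")
      by auto
    have "filter (\<lambda>x. x \<in> A) ?s = filter (\<lambda>x. x \<in> A) w" "filter (\<lambda>x. x \<in> B) ?s = filter (\<lambda>x. x \<in> B) w"
      by (auto intro!: filter_cong)
    moreover have "filter (\<lambda>x. x \<in> A) ?s = u" "filter (\<lambda>x. x \<in> B) ?s = v"
      using filter_shuffles_disjoint1(1)[OF _ s] filter_shuffles_disjoint2(1)[OF _ s] sets disj by simp_all
    ultimately show "w \<in> {w. w \<in> permutations_of_set C \<and> filter (\<lambda>x. x \<in> A) w = u \<and> filter (\<lambda>x. x \<in> B) w = v}"
      using w by simp
  qed
  then have "(\<Sum>w | w \<in> permutations_of_set C \<and> filter (\<lambda>x. x \<in> A) w = u \<and> filter (\<lambda>x. x \<in> B) w = v. q ^ rmaj w) =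
      (\<Sum>s\<in>shuffles u v. \<Sum>w | w \<in> permutations_of_set C \<and> filter (\<lambda>x. x \<in> A \<union> B) w = s. q ^ rmaj w)"
    by (simp only:) (subst sum.UNION_disjoint; auto)
  also have "\<dots> = (\<Sum>s\<in>shuffles u v. q ^ rmaj s * (q_fact q (card C) / q_fact q (card (A \<union> B))))"
    using sum_rmaj_filter[OF q assms(2), of "A \<union> B"] assms(3,4) sh by (intro sum.cong refl) simp
  also have "\<dots> = q ^ (rmaj u + rmaj v) * gauss_binomial q (card A) (card B) * (q_fact q (card C) / q_fact q (card (A \<union> B)))"
    using sum_rmaj_shuffles[OF q, of u v] sets disj length_permutations_of_set[OF u] length_permutations_of_set[OF v]
    unfolding sum_distrib_right[symmetric] by simp
  also have "\<dots> = q ^ rmaj u * q ^ rmaj v * q_fact q (card C) / (q_fact q (card A) * q_fact q (card B))"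
    using card_Un_disjoint[OF fin disj] q_fact_pos[OF q, of "card (A \<union> B)"]
    by (simp add: gauss_binomial_def power_add)
  finally show ?thesis .
qed

section \<open>Permutations as reversed words\<close>

definition rword :: "nat \<Rightarrow> (nat \<Rightarrow> nat) \<Rightarrow> nat list" where
  "rword n \<pi> = rev (map \<pi> [1..<Suc n])"

text \<open>Going from \<open>n\<close> to \<open>n + 1\<close> puts a new letter at the head, and a
  descent at position \<open>n\<close> adds \<open>n\<close>, the length of the rest of the
  list.\<close>

lemma rmaj_rword: "rmaj (rword n \<pi>) = maj n \<pi>"
proof (induction n)
  case 0
  then show ?case by (simp add: rword_def maj_def)
next
  case (Suc n)
  show ?case
  proof (cases n)
    case 0
    then show ?thesis by (simp add: rword_def maj_def)
  next
    case (Suc m)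
    have "{i \<in> {1..<Suc n}. \<pi> (i + 1) < \<pi> i} =
        (if \<pi> (n + 1) < \<pi> n then insert n else id) {i \<in> {1..<n}. \<pi> (i + 1) < \<pi> i}"
      using Suc by (auto simp: less_Suc_eq)
    then have "maj (Suc n) \<pi> = (if \<pi> (Suc n) < \<pi> n then n else 0) + maj n \<pi>"
      by (simp add: maj_def)
    moreover have "rword (Suc n) \<pi> = \<pi> (Suc n) # \<pi> n # rword m \<pi>" "rword n \<pi> = \<pi> n # rword m \<pi>"
      using Suc by (simp_all add: rword_def)
    moreover have "Suc (length (rword m \<pi>)) = n"
      using Suc by (simp add: rword_def)
    ultimately show ?thesis
      using Suc.IH by simp
  qed
qed

lemma set_rword: "set (rword n \<pi>) = \<pi> ` {1..n}"
  by (auto simp: rword_def)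

lemma distinct_rword: "distinct (rword n \<pi>) \<longleftrightarrow> inj_on \<pi> {1..n}"
  by (simp add: rword_def distinct_map atLeastLessThanSuc_atLeastAtMost del: upt_Suc)

lemma bij_betw_rword:
  "bij_betw (rword n) {\<pi>. \<pi> permutes {1..n}} (permutations_of_set {1..n})"
proof -
  have inj: "inj_on (rword n) {\<pi>. \<pi> permutes {1..n}}"
  proof (rule inj_onI)
    fix \<pi> \<rho> assume P: "\<pi> \<in> {\<pi>. \<pi> permutes {1..n}}" "\<rho> \<in> {\<pi>. \<pi> permutes {1..n}}" "rword n \<pi> = rword n \<rho>"
    then have "\<pi> i = \<rho> i" if "i \<in> {1..n}" for i
      using that P(3) by (auto simp: rword_def atLeastLessThanSuc_atLeastAtMost simp del: upt_Suc)
    moreover have "\<pi> i = \<rho> i" if "i \<notin> {1..n}" for i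
      using P that by (simp add: permutes_not_in)
    ultimately show "\<pi> = \<rho>"
      by blast
  qed
  moreover have sub: "rword n ` {\<pi>. \<pi> permutes {1..n}} \<subseteq> permutations_of_set {1..n}"
  proof
    fix w assume "w \<in> rword n ` {\<pi>. \<pi> permutes {1..n}}"
    then obtain \<pi> where "w = rword n \<pi>" "\<pi> permutes {1..n}"
      by blast
    then show "w \<in> permutations_of_set {1..n}"
      using set_rword[of n \<pi>] distinct_rword[of n \<pi>] permutes_image[of \<pi> "{1..n}"]
        permutes_inj_on[of \<pi> "{1..n}" "{1..n}"] by auto
  qed
  \<comment> \<open>Surjectivity follows by counting, since both sets have n! elements.\<close>
  moreover have "card (rword n ` {\<pi>. \<pi> permutes {1..n}}) = card (permutations_of_set {1..n})"
    using card_image[OF inj] card_permutations[of "{1..n}" n] by simp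
  ultimately show ?thesis
    unfolding bij_betw_def using card_subset_eq[OF finite_permutations_of_set sub] by blast
qed

section \<open>Occurrences and their sets of values\<close>

text \<open>Counting starts at 1, so that for finite \<open>A\<close> this is the increasing
  bijection from \<open>{1..card A}\<close> onto \<open>A\<close> and composes with permutations of
  \<open>{1..k}\<close>.\<close>

definition nth_least :: "nat set \<Rightarrow> nat \<Rightarrow> nat" where
  "nth_least A j = sorted_list_of_set A ! (j - 1)"

lemma sorted_list_of_set_strict_mono_image:
  assumes "strict_mono_on {1..k} f"
  shows "sorted_list_of_set (f ` {1..k}) = map f [1..<Suc k]"
proof -
  have "sorted_wrt (<) (map f [1..<Suc k])"
    unfolding sorted_wrt_map
    by (rule sorted_wrt_mono_rel[OF _ sorted_wrt_upt]) (use assms in \<open>auto simp: strict_mono_on_def\<close>)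
  moreover have "set (map f [1..<Suc k]) = f ` {1..k}"
    by (auto simp flip: atLeastLessThanSuc_atLeastAtMost)
  ultimately show ?thesis
    by (metis strict_sorted_iff sorted_list_of_set.idem_if_sorted_distinct)
qed

text \<open>An increasing tuple is recovered from its image, so index tuples can be traded for
  sets.\<close>

lemma nth_least_strict_mono_image:
  assumes "strict_mono_on {1..k} f" and "j \<in> {1..k}"
  shows "nth_least (f ` {1..k}) j = f j"
  unfolding nth_least_def sorted_list_of_set_strict_mono_image[OF assms(1)]
  using assms(2) by (auto simp del: upt_Suc)

lemma strict_mono_on_nth_least:
  assumes "finite A"
  shows "strict_mono_on {1..card A} (nth_least A)"
  unfolding strict_mono_on_def nth_least_def
  using assms by (auto intro!: sorted_wrt_nth_less[OF strict_sorted_list_of_set])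

lemma map_nth_least:
  assumes "finite A"
  shows "map (nth_least A) [1..<Suc (card A)] = sorted_list_of_set A"
  by (rule nth_equalityI) (use assms in \<open>auto simp: nth_least_def simp del: upt_Suc\<close>)

lemma nth_least_image:
  assumes "finite A"
  shows "nth_least A ` {1..card A} = A"
  using arg_cong[OF map_nth_least[OF assms], of set] assms
  by (simp add: atLeastLessThanSuc_atLeastAtMost del: upt_Suc)

text \<open>When \<open>card A = k\<close>, this is the arrangement of \<open>A\<close> with pattern
  \<open>\<sigma>\<close>, read backwards to match \<open>rword\<close>.\<close>

definition pattern_word :: "nat \<Rightarrow> (nat \<Rightarrow> nat) \<Rightarrow> nat set \<Rightarrow> nat list" where
  "pattern_word k \<sigma> A = rword k (nth_least A \<circ> \<sigma>)"

lemma pattern_word_permutations_of_set: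
  assumes "finite A" "card A = k" "\<sigma> permutes {1..k}"
  shows "pattern_word k \<sigma> A \<in> permutations_of_set A"
proof -
  have "inj_on (nth_least A) {1..k}"
    using strict_mono_on_nth_least[OF assms(1)] assms(2) by (simp add: strict_mono_on_imp_inj_on)
  then have "inj_on (nth_least A \<circ> \<sigma>) {1..k}"
    using assms(3) by (simp add: comp_inj_on permutes_image permutes_inj_on)
  moreover have "(nth_least A \<circ> \<sigma>) ` {1..k} = A"
    using nth_least_image[OF assms(1)] assms(2) permutes_image[OF assms(3)] by (simp only: image_comp[symmetric])
  ultimately show ?thesis
    using set_rword[of k "nth_least A \<circ> \<sigma>"] distinct_rword[of k "nth_least A \<circ> \<sigma>"]
    by (auto simp: pattern_word_def)
qed

lemma rmaj_pattern_word:
  assumes "finite A" "card A = k" "\<sigma> permutes {1..k}"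
  shows "rmaj (pattern_word k \<sigma> A) = maj k \<sigma>"
proof -
  have "nth_least A (\<sigma> (i + 1)) < nth_least A (\<sigma> i) \<longleftrightarrow> \<sigma> (i + 1) < \<sigma> i" if "i \<in> {1..<k}" for i
  proof -
    have "i \<in> {1..k}" "i + 1 \<in> {1..k}"
      using that by auto
    then have "\<sigma> i \<in> {1..k}" "\<sigma> (i + 1) \<in> {1..k}"
      by (simp_all only: permutes_in_image[OF assms(3)])
    then show ?thesis
      using strict_mono_on_less[OF strict_mono_on_nth_least[OF assms(1)]] assms(2) by simp
  qed
  then have "maj k (nth_least A \<circ> \<sigma>) = maj k \<sigma>"
    unfolding maj_def by (intro sum.cong) auto
  then show ?thesis
    by (simp add: pattern_word_def rmaj_rword)
qed

text \<open>The bridge from values to positions: filtering keeps exactly the letters at the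
  positions in \<open>I\<close>, in the order of these positions.\<close>

lemma filter_rword:
  assumes "I = {i \<in> {1..n}. \<pi> i \<in> A}"
  shows "filter (\<lambda>x. x \<in> A) (rword n \<pi>) = rword (card I) (\<pi> \<circ> nth_least I)"
proof -
  have fin: "finite I"
    using assms by simp
  have "filter (\<lambda>x. x \<in> A) (rword n \<pi>) = rev (map \<pi> (filter (\<lambda>i. \<pi> i \<in> A) [1..<Suc n]))"
    by (simp add: rword_def filter_map o_def del: upt_Suc flip: rev_filter)
  also have "filter (\<lambda>i. \<pi> i \<in> A) [1..<Suc n] = map (nth_least I) [1..<Suc (card I)]"
    unfolding map_nth_least[OF fin]
    by (rule sorted_distinct_set_unique)
      (use assms in \<open>auto intro: sorted_wrt_filter simp: atLeastLessThanSuc_atLeastAtMost simp del: upt_Suc\<close>)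
  finally show ?thesis
    by (simp add: rword_def del: upt_Suc)
qed

text \<open>The set of values of an occurrence determines its set of positions, as
  \<open>\<pi>\<close> is injective, and hence the tuple, as it is increasing. The order condition
  on the tuple becomes the condition on the subword.\<close>

lemma bij_betw_occurrences:
  assumes \<pi>: "\<pi> permutes {1..n}" and \<sigma>: "\<sigma> permutes {1..k}"
  shows "bij_betw (\<lambda>\<iota>. \<pi> ` \<iota> ` {1..k}) (occurrences k \<sigma> n \<pi>)
    {A. A \<subseteq> {1..n} \<and> card A = k \<and> filter (\<lambda>x. x \<in> A) (rword n \<pi>) = pattern_word k \<sigma> A}"
  unfolding bij_betw_def
proof (intro conjI inj_onI equalityI subsetI)
  fix \<iota> \<kappa> assume \<iota>: "\<iota> \<in> occurrences k \<sigma> n \<pi>" and \<kappa>: "\<kappa> \<in> occurrences k \<sigma> n \<pi>"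
    and "\<pi> ` \<iota> ` {1..k} = \<pi> ` \<kappa> ` {1..k}"
  then have "\<iota> ` {1..k} = \<kappa> ` {1..k}"
    by (simp only: inj_image_eq_iff[OF permutes_inj[OF \<pi>]])
  then have "\<iota> j = \<kappa> j" if "j \<in> {1..k}" for j
    using \<iota> \<kappa> nth_least_strict_mono_image[OF _ that] unfolding occurrences_def
    by (metis (no_types, lifting) mem_Collect_eq)
  then show "\<iota> = \<kappa>"
    using \<iota> \<kappa> unfolding occurrences_def by (blast intro: PiE_ext[of \<iota> "{1..k}" "\<lambda>_. {1..n}" \<kappa>])
next
  fix A assume "A \<in> (\<lambda>\<iota>. \<pi> ` \<iota> ` {1..k}) ` occurrences k \<sigma> n \<pi>"
  then obtain \<iota> where A: "A = \<pi> ` \<iota> ` {1..k}" and \<iota>: "\<iota> \<in> occurrences k \<sigma> n \<pi>"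
    by blast
  have mono: "strict_mono_on {1..k} \<iota>" and sub: "\<iota> ` {1..k} \<subseteq> {1..n}"
    and iso: "\<And>a b. a \<in> {1..k} \<Longrightarrow> b \<in> {1..k} \<Longrightarrow> \<pi> (\<iota> a) < \<pi> (\<iota> b) \<longleftrightarrow> \<sigma> a < \<sigma> b"
    using \<iota> by (auto simp: occurrences_def)
  have inv: "inv \<sigma> permutes {1..k}"
    using \<sigma> by (rule permutes_inv)
  have "card A = card (\<iota> ` {1..k})"
    unfolding A by (rule card_image) (rule permutes_inj_on[OF \<pi>])
  also have "\<dots> = k"
    using card_image[OF strict_mono_on_imp_inj_on[OF mono]] by simp
  finally have card: "card A = k" .
  have I: "\<iota> ` {1..k} = {i \<in> {1..n}. \<pi> i \<in> A}"
    unfolding A using sub inj_image_mem_iff[OF permutes_inj[OF \<pi>]] by auto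
  have cardI: "card (\<iota> ` {1..k}) = k"
    using card_image[OF strict_mono_on_imp_inj_on[OF mono]] by simp
  \<comment> \<open>Composing with \<open>inv \<sigma>\<close> sorts the values of the occurrence,
    so this map must be \<open>nth_least A\<close> on \<open>{1..k}\<close>.\<close>
  have "strict_mono_on {1..k} (\<pi> \<circ> \<iota> \<circ> inv \<sigma>)"
  proof (rule strict_mono_onI)
    fix a b assume ab: "a \<in> {1..k}" "b \<in> {1..k}" "a < b"
    then have "inv \<sigma> a \<in> {1..k}" "inv \<sigma> b \<in> {1..k}"
      by (simp_all only: permutes_in_image[OF inv])
    then show "(\<pi> \<circ> \<iota> \<circ> inv \<sigma>) a < (\<pi> \<circ> \<iota> \<circ> inv \<sigma>) b"
      using iso ab(3) permutes_inverses(1)[OF \<sigma>] by simp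
  qed
  moreover have "(\<pi> \<circ> \<iota> \<circ> inv \<sigma>) ` {1..k} = A"
    unfolding A using permutes_image[OF inv] by (simp only: image_comp[symmetric])
  ultimately have nl: "nth_least A j = \<pi> (\<iota> (inv \<sigma> j))" if "j \<in> {1..k}" for j
    using nth_least_strict_mono_image[of k "\<pi> \<circ> \<iota> \<circ> inv \<sigma>" j] that by simp
  have "filter (\<lambda>x. x \<in> A) (rword n \<pi>) = rword k (\<pi> \<circ> nth_least (\<iota> ` {1..k}))"
    using filter_rword[OF I] cardI by simp
  also have "\<dots> = pattern_word k \<sigma> A"
    unfolding pattern_word_def rword_def
  proof (intro arg_cong[where f = rev] map_cong refl)
    fix j assume "j \<in> set [1..<Suc k]"
    then have j: "j \<in> {1..k}"
      by auto
    then have "\<sigma> j \<in> {1..k}"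
      by (simp only: permutes_in_image[OF \<sigma>])
    then show "(\<pi> \<circ> nth_least (\<iota> ` {1..k})) j = (nth_least A \<circ> \<sigma>) j"
      using nl nth_least_strict_mono_image[OF mono j] permutes_inverses(2)[OF \<sigma>] by simp
  qed
  finally have "filter (\<lambda>x. x \<in> A) (rword n \<pi>) = pattern_word k \<sigma> A" .
  moreover have "A \<subseteq> {1..n}"
    unfolding A using sub permutes_image[OF \<pi>] by blast
  ultimately show "A \<in> {A. A \<subseteq> {1..n} \<and> card A = k \<and> filter (\<lambda>x. x \<in> A) (rword n \<pi>) = pattern_word k \<sigma> A}"
    using card by simp
next
  fix A assume "A \<in> {A. A \<subseteq> {1..n} \<and> card A = k \<and> filter (\<lambda>x. x \<in> A) (rword n \<pi>) = pattern_word k \<sigma> A}"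
  then have A: "A \<subseteq> {1..n}" and card: "card A = k"
    and word: "filter (\<lambda>x. x \<in> A) (rword n \<pi>) = pattern_word k \<sigma> A"
    by auto
  have finA: "finite A"
    using A by (rule finite_subset) simp
  define I where "I = {i \<in> {1..n}. \<pi> i \<in> A}"
  have finI: "finite I"
    by (simp add: I_def)
  have image: "\<pi> ` I = A"
  proof (intro equalityI subsetI)
    fix x assume "x \<in> A"
    then have "x \<in> \<pi> ` {1..n}"
      using A by (simp only: permutes_image[OF \<pi>] subsetD)
    then show "x \<in> \<pi> ` I"
      using \<open>x \<in> A\<close> by (auto simp: I_def)
  qed (auto simp: I_def)
  then have cardI: "card I = k"
    using card card_image[OF permutes_inj_on[OF \<pi>], of I] by simp
  \<comment> \<open>The only candidate is the increasing list of the positions of \<open>A\<close>;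
    \<open>restrict\<close> gives the value \<open>undefined\<close> outside \<open>{1..k}\<close>
    that \<open>PiE\<close> demands.\<close>
  define \<iota> where "\<iota> = restrict (nth_least I) {1..k}"
  have im\<iota>: "\<iota> ` {1..k} = I"
    using nth_least_image[OF finI] cardI by (simp add: \<iota>_def)
  have "rword k (\<pi> \<circ> nth_least I) = rword k (nth_least A \<circ> \<sigma>)"
    using word filter_rword[OF I_def] cardI by (simp add: pattern_word_def)
  then have eq: "\<pi> (\<iota> j) = nth_least A (\<sigma> j)" if "j \<in> {1..k}" for j
    using that by (auto simp: rword_def \<iota>_def atLeastLessThanSuc_atLeastAtMost simp del: upt_Suc)
  have "strict_mono_on {1..k} \<iota>"
    using strict_mono_on_nth_least[OF finI] cardI by (simp add: \<iota>_def strict_mono_on_def)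
  moreover have "\<iota> \<in> {1..k} \<rightarrow>\<^sub>E {1..n}"
    using im\<iota> unfolding I_def by (auto simp: \<iota>_def)
  moreover have "\<pi> (\<iota> a) < \<pi> (\<iota> b) \<longleftrightarrow> \<sigma> a < \<sigma> b" if "a \<in> {1..k}" "b \<in> {1..k}" for a b
  proof -
    have "\<sigma> a \<in> {1..k}" "\<sigma> b \<in> {1..k}"
      using that by (simp_all only: permutes_in_image[OF \<sigma>])
    then show ?thesis
      using eq that card strict_mono_on_less[OF strict_mono_on_nth_least[OF finA]] by simp
  qed
  ultimately have "\<iota> \<in> occurrences k \<sigma> n \<pi>"
    by (simp add: occurrences_def)
  then show "A \<in> (\<lambda>\<iota>. \<pi> ` \<iota> ` {1..k}) ` occurrences k \<sigma> n \<pi>"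
    using im\<iota> image by blast
qed

section \<open>The expectation\<close>

text \<open>Turns expectations into finite weighted sums over words, where the shuffle identities
  apply.\<close>

lemma integral_Maj:
  fixes g :: "_ \<Rightarrow> real"
  assumes q: "0 < q" and "\<And>\<pi>. \<pi> permutes {1..n} \<Longrightarrow> g \<pi> = h (rword n \<pi>)"
  shows "integral\<^sup>L (Maj n q) g =
    (\<Sum>w\<in>permutations_of_set {1..n}. q ^ rmaj w / q_fact q n * h w)"
proof -
  have "integral\<^sup>L (Maj n q) g = (\<Sum>\<pi> | \<pi> permutes {1..n}. q ^ maj n \<pi> / q_fact q n * g \<pi>)"
    unfolding Maj_def using q q_fact_pos[OF q, of n] finite_permutations[of "{1..n}"]
    by (subst lebesgue_integral_point_measure_finite) (auto simp: less_imp_le)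
  also have "\<dots> = (\<Sum>\<pi> | \<pi> permutes {1..n}. q ^ rmaj (rword n \<pi>) / q_fact q n * h (rword n \<pi>))"
    using assms(2) by (intro sum.cong) (auto simp: rmaj_rword)
  also have "\<dots> = (\<Sum>w\<in>permutations_of_set {1..n}. q ^ rmaj w / q_fact q n * h w)"
    by (rule sum.reindex_bij_betw[OF bij_betw_rword])
  finally show ?thesis .
qed

lemma pattern_count_eq_sum:
  assumes "\<pi> permutes {1..n}" "\<sigma> permutes {1..k}"
  shows "real (pattern_count k \<sigma> n \<pi>) =
    (\<Sum>A | A \<subseteq> {1..n} \<and> card A = k. of_bool (filter (\<lambda>x. x \<in> A) (rword n \<pi>) = pattern_word k \<sigma> A))"
proof -
  have "finite {A. A \<subseteq> {1..n} \<and> card A = k}"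
    by simp
  moreover have "pattern_count k \<sigma> n \<pi> =
      card {A. A \<subseteq> {1..n} \<and> card A = k \<and> filter (\<lambda>x. x \<in> A) (rword n \<pi>) = pattern_word k \<sigma> A}"
    unfolding pattern_count_def by (rule bij_betw_same_card[OF bij_betw_occurrences[OF assms]])
  ultimately show ?thesis
    by (simp add: of_bool_def sum.If_cases Int_def conj_ac)
qed

text \<open>Linearity over the k-sets \<open>A\<close>: each contributes the same probability,
  because \<open>rmaj\<close> of its pattern word is \<open>maj k \<sigma>\<close> whatever
  \<open>A\<close> is.\<close>

lemma expectation_pattern_count:
  assumes q: "0 < q" and \<sigma>: "\<sigma> permutes {1..k}"
  shows "integral\<^sup>L (Maj n q) (\<lambda>\<pi>. real (pattern_count k \<sigma> n \<pi>)) =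
    real (n choose k) * (q ^ maj k \<sigma> / q_fact q k)"
proof -
  define S where "S = {A. A \<subseteq> {1..n} \<and> card A = k}"
  define X where "X A w = (of_bool (filter (\<lambda>x. x \<in> A) w = pattern_word k \<sigma> A) :: real)" for A w
  have "integral\<^sup>L (Maj n q) (\<lambda>\<pi>. real (pattern_count k \<sigma> n \<pi>)) =
      (\<Sum>w\<in>permutations_of_set {1..n}. q ^ rmaj w / q_fact q n * (\<Sum>A\<in>S. X A w))"
    by (rule integral_Maj[OF q]) (simp add: pattern_count_eq_sum[OF _ \<sigma>] S_def X_def)
  also have "\<dots> = (\<Sum>A\<in>S. \<Sum>w\<in>permutations_of_set {1..n}. q ^ rmaj w / q_fact q n * X A w)"
    unfolding sum_distrib_left by (rule sum.swap)
  also have "\<dots> = (\<Sum>A\<in>S. q ^ maj k \<sigma> / q_fact q k)"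
  proof (intro sum.cong refl)
    fix A assume "A \<in> S"
    then have A: "A \<subseteq> {1..n}" "card A = k"
      by (auto simp: S_def)
    then have fin: "finite A"
      by (auto intro: finite_subset)
    have "(\<Sum>w\<in>permutations_of_set {1..n}. q ^ rmaj w / q_fact q n * X A w) =
        (\<Sum>w | w \<in> permutations_of_set {1..n} \<and> filter (\<lambda>x. x \<in> A) w = pattern_word k \<sigma> A. q ^ rmaj w) / q_fact q n"
      unfolding sum_divide_distrib by (rule sum.mono_neutral_cong_right) (auto simp: X_def)
    then show "(\<Sum>w\<in>permutations_of_set {1..n}. q ^ rmaj w / q_fact q n * X A w) = q ^ maj k \<sigma> / q_fact q k"
      using sum_rmaj_filter[OF q _ A(1) pattern_word_permutations_of_set[OF fin A(2) \<sigma>]]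
        rmaj_pattern_word[OF fin A(2) \<sigma>] A(2) q_fact_pos[OF q, of n] by simp
  qed
  also have "\<dots> = real (n choose k) * (q ^ maj k \<sigma> / q_fact q k)"
    using n_subsets[of "{1..n}" k] by (simp add: S_def)
  finally show ?thesis .
qed

section \<open>The variance\<close>

text \<open>A union bound over a common element \<open>x\<close>, with \<open>n\<close> choices.
  Deleting \<open>x\<close> is injective on the k-sets through it, so each set of the pair has at
  most \<open>n ^ (k - 1)\<close> choices, and 1 + 2(k-1) = 2k-1.\<close>

lemma card_intersecting_pairs:
  assumes "1 \<le> k"
  shows "card {(A, B). A \<subseteq> {1..n} \<and> card A = k \<and> B \<subseteq> {1..n} \<and> card B = k \<and> A \<inter> B \<noteq> {}} \<le> n ^ (2 * k - 1)"
proof -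
  define S where "S x = {A. A \<subseteq> {1..n} \<and> card A = k \<and> x \<in> A}" for x
  have fin: "finite (S x)" for x
    by (rule finite_subset[of _ "Pow {1..n}"]) (auto simp: S_def)
  have card_S: "card (S x) \<le> n ^ (k - 1)" for x
  proof -
    have "card (S x) \<le> card {B. B \<subseteq> {1..n} \<and> card B = k - 1}"
    proof (rule card_inj_on_le)
      show "inj_on (\<lambda>A. A - {x}) (S x)"
        by (rule inj_onI) (auto simp: S_def)
      show "(\<lambda>A. A - {x}) ` S x \<subseteq> {B. B \<subseteq> {1..n} \<and> card B = k - 1}"
        by (auto simp: S_def card_Diff_singleton_if)
    qed simp
    also have "\<dots> = n choose (k - 1)"
      using n_subsets[of "{1..n}" "k - 1"] by simp
    also have "\<dots> \<le> n ^ (k - 1)"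
      by (cases "k - 1 \<le> n") (simp_all add: binomial_le_pow binomial_eq_0 not_le)
    finally show ?thesis .
  qed
  have "card {(A, B). A \<subseteq> {1..n} \<and> card A = k \<and> B \<subseteq> {1..n} \<and> card B = k \<and> A \<inter> B \<noteq> {}} \<le>
      card (\<Union>x\<in>{1..n}. S x \<times> S x)"
    by (rule card_mono) (use fin in \<open>auto simp: S_def\<close>)
  also have "\<dots> \<le> (\<Sum>x\<in>{1..n}. card (S x \<times> S x))"
    by (rule card_UN_le) simp
  also have "\<dots> \<le> (\<Sum>x\<in>{1..n}. n ^ (k - 1) * n ^ (k - 1))"
    unfolding card_cartesian_product by (intro sum_mono mult_mono card_S) simp_all
  also have "\<dots> = n ^ Suc ((k - 1) + (k - 1))"
    by (simp add: power_add)
  also have "Suc ((k - 1) + (k - 1)) = 2 * k - 1"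
    using assms by simp
  finally show ?thesis .
qed

text \<open>The variance is the sum over pairs \<open>A\<close>, \<open>B\<close> of the joint
  probability minus \<open>c^2\<close>. Disjoint pairs cancel by independence and every other pair
  contributes at most 1, so the bound holds with constant 1.\<close>

lemma variance_pattern_count_le:
  assumes q: "0 < q" and k: "1 \<le> k" and \<sigma>: "\<sigma> permutes {1..k}"
  defines "\<mu> n \<equiv> integral\<^sup>L (Maj n q) (\<lambda>\<pi>. real (pattern_count k \<sigma> n \<pi>))"
  shows "integral\<^sup>L (Maj n q) (\<lambda>\<pi>. (real (pattern_count k \<sigma> n \<pi>) - \<mu> n)\<^sup>2) \<le> real n ^ (2 * k - 1)"
proof -
  define S where "S = {A. A \<subseteq> {1..n} \<and> card A = k}"
  define X where "X A w = (of_bool (filter (\<lambda>x. x \<in> A) w = pattern_word k \<sigma> A) :: real)" for A w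
  define p where "p w = q ^ rmaj w / q_fact q n" for w :: "nat list"
  define c where "c = q ^ maj k \<sigma> / q_fact q k"
  define W where "W = permutations_of_set {1..n}"
  define T where "T w = (\<Sum>A\<in>S. X A w)" for w
  have finS: "finite S"
    by (simp add: S_def)
  have card_S: "card S = n choose k"
    using n_subsets[of "{1..n}" k] by (simp add: S_def)
  have p_nonneg: "0 \<le> p w" for w
    using q q_fact_pos[OF q, of n] by (simp add: p_def less_imp_le)
  have sum_p: "(\<Sum>w\<in>W. p w) = 1"
    using sum_rmaj_permutations_of_set[OF q, of "{1..n}"] q_fact_pos[OF q, of n]
    by (simp add: p_def W_def flip: sum_divide_distrib)
  have count: "real (pattern_count k \<sigma> n \<pi>) = T (rword n \<pi>)" if "\<pi> permutes {1..n}" for \<pi>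
    using pattern_count_eq_sum[OF that \<sigma>] by (simp add: S_def X_def T_def)
  have mean: "\<mu> n = card S * c"
    using expectation_pattern_count[OF q \<sigma>, of n] card_S by (simp add: \<mu>_def c_def)
  have mean': "\<mu> n = (\<Sum>w\<in>W. p w * T w)"
    unfolding \<mu>_def p_def W_def by (rule integral_Maj[OF q]) (rule count)
  have joint: "(\<Sum>w\<in>W. p w * (X A w * X B w)) \<le> c\<^sup>2 + of_bool (A \<inter> B \<noteq> {})" if "A \<in> S" "B \<in> S" for A B
  proof (cases "A \<inter> B = {}")
    case True
    have AB: "A \<subseteq> {1..n}" "card A = k" "B \<subseteq> {1..n}" "card B = k"
      using that by (auto simp: S_def)
    then have fin: "finite A" "finite B"
      by (auto intro: finite_subset)
    have "(\<Sum>w\<in>W. p w * (X A w * X B w)) =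
        (\<Sum>w | w \<in> W \<and> filter (\<lambda>x. x \<in> A) w = pattern_word k \<sigma> A \<and> filter (\<lambda>x. x \<in> B) w = pattern_word k \<sigma> B.
          q ^ rmaj w) / q_fact q n"
      unfolding sum_divide_distrib by (rule sum.mono_neutral_cong_right) (auto simp: X_def p_def W_def)
    also have "\<dots> = c\<^sup>2"
      unfolding W_def
      using sum_rmaj_filter_disjoint[OF q _ AB(1,3) True
          pattern_word_permutations_of_set[OF fin(1) AB(2) \<sigma>] pattern_word_permutations_of_set[OF fin(2) AB(4) \<sigma>]]
        rmaj_pattern_word[OF fin(1) AB(2) \<sigma>] rmaj_pattern_word[OF fin(2) AB(4) \<sigma>] AB q_fact_pos[OF q, of n]
      by (simp add: c_def power2_eq_square)
    finally show ?thesis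
      by simp
  next
    case False
    have "(\<Sum>w\<in>W. p w * (X A w * X B w)) \<le> (\<Sum>w\<in>W. p w)"
      by (intro sum_mono) (simp add: X_def p_nonneg)
    then show ?thesis
      using False sum_p by (simp add: add_increasing)
  qed
  have "integral\<^sup>L (Maj n q) (\<lambda>\<pi>. (real (pattern_count k \<sigma> n \<pi>) - \<mu> n)\<^sup>2) = (\<Sum>w\<in>W. p w * (T w - \<mu> n)\<^sup>2)"
    unfolding p_def W_def by (rule integral_Maj[OF q]) (simp add: count)
  also have "\<dots> = (\<Sum>w\<in>W. p w * (T w)\<^sup>2 - 2 * \<mu> n * (p w * T w) + (\<mu> n)\<^sup>2 * p w)"
    by (intro sum.cong refl) (simp add: power2_diff algebra_simps)
  also have "\<dots> = (\<Sum>w\<in>W. p w * (T w)\<^sup>2) - 2 * \<mu> n * (\<Sum>w\<in>W. p w * T w) + (\<mu> n)\<^sup>2 * (\<Sum>w\<in>W. p w)"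
    by (simp only: sum.distrib sum_subtractf sum_distrib_left)
  also have "\<dots> = (\<Sum>w\<in>W. p w * (T w)\<^sup>2) - (\<mu> n)\<^sup>2"
    by (simp add: sum_p power2_eq_square flip: mean')
  also have "(\<Sum>w\<in>W. p w * (T w)\<^sup>2) = (\<Sum>w\<in>W. \<Sum>A\<in>S. \<Sum>B\<in>S. p w * (X A w * X B w))"
    by (simp only: T_def power2_eq_square sum_product) (simp only: sum_distrib_left)
  also have "\<dots> = (\<Sum>A\<in>S. \<Sum>B\<in>S. \<Sum>w\<in>W. p w * (X A w * X B w))"
    by (subst sum.swap, intro sum.cong refl, rule sum.swap)
  also have "\<dots> \<le> (\<Sum>A\<in>S. \<Sum>B\<in>S. c\<^sup>2 + of_bool (A \<inter> B \<noteq> {}))"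
    by (intro sum_mono joint)
  \<comment> \<open>The terms \<open>c^2\<close> add up to \<open>(card S * c)^2\<close>, the square
    of the mean; the rest counts the intersecting pairs.\<close>
  also have "\<dots> = (\<mu> n)\<^sup>2 + (\<Sum>(A, B)\<in>S \<times> S. of_bool (A \<inter> B \<noteq> {}))"
    by (simp add: sum.distrib mean power2_eq_square sum.cartesian_product)
  also have "(\<Sum>(A, B)\<in>S \<times> S. of_bool (A \<inter> B \<noteq> {})) =
      real (card {(A, B). A \<subseteq> {1..n} \<and> card A = k \<and> B \<subseteq> {1..n} \<and> card B = k \<and> A \<inter> B \<noteq> {}})"
  proof -
    have "(\<Sum>(A, B)\<in>S \<times> S. of_bool (A \<inter> B \<noteq> {})) = (\<Sum>z | z \<in> S \<times> S \<and> fst z \<inter> snd z \<noteq> {}. 1 :: real)"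
      by (rule sum.mono_neutral_cong_right) (auto simp: finS)
    also have "{z. z \<in> S \<times> S \<and> fst z \<inter> snd z \<noteq> {}} =
        {(A, B). A \<subseteq> {1..n} \<and> card A = k \<and> B \<subseteq> {1..n} \<and> card B = k \<and> A \<inter> B \<noteq> {}}"
      by (auto simp: S_def)
    finally show ?thesis
      by simp
  qed
  also have "\<dots> \<le> real n ^ (2 * k - 1)"
    using card_intersecting_pairs[OF k, of n] by (simp flip: of_nat_power)
  finally show ?thesis
    by simp
qed

section \<open>Asymptotics\<close>

text \<open>For \<open>n \<ge> k\<close> the binomial coefficient lies between (n/k)^k and
  n^k.\<close>

lemma binomial_bigtheta:
  assumes "1 \<le> k"
  shows "(\<lambda>n. real (n choose k)) \<in> \<Theta>(\<lambda>n. real n ^ k)"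
proof (rule bigthetaI)
  have "real (n choose k) \<le> real n ^ k" if "k \<le> n" for n
    using binomial_le_pow[OF that] by (simp flip: of_nat_power)
  then show "(\<lambda>n. real (n choose k)) \<in> O(\<lambda>n. real n ^ k)"
    by (intro bigoI[of _ 1] eventually_sequentiallyI[of k]) simp
  have "(1 / real k) ^ k * real n ^ k \<le> real (n choose k)" if "k \<le> n" for n
    using binomial_ge_n_over_k_pow_k[OF that, where 'a = real] by (simp add: power_divide)
  then show "(\<lambda>n. real (n choose k)) \<in> \<Omega>(\<lambda>n. real n ^ k)"
    using assms
    by (intro landau_omega.bigI[of "(1 / real k) ^ k"] eventually_sequentiallyI[of k]) auto
qed

theorem theorem5p3:
  fixes q :: real and k :: nat and \<sigma> :: "nat \<Rightarrow> nat"
  assumes "q > 0" and "k \<ge> 1" and "\<sigma> permutes {1..k}"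
  shows "(\<forall>n\<ge>k. prob_space.expectation (Maj n q) (\<lambda>\<pi>. real (pattern_count k \<sigma> n \<pi>))
                   = real (n choose k) * (q ^ maj k \<sigma> / q_fact q k))
       \<and> (\<lambda>n. prob_space.expectation (Maj n q) (\<lambda>\<pi>. real (pattern_count k \<sigma> n \<pi>)))
            \<in> \<Theta>(\<lambda>n. real n ^ k)
       \<and> (\<lambda>n. prob_space.variance (Maj n q) (\<lambda>\<pi>. real (pattern_count k \<sigma> n \<pi>)))
            \<in> O(\<lambda>n. real n ^ (2 * k - 1))"
proof (intro conjI allI impI)
  \<comment> \<open>The expectation is a constant multiple of the binomial coefficient; a nonzero
    constant leaves the order of growth unchanged.\<close>
  have "q ^ maj k \<sigma> / q_fact q k \<noteq> 0"
    using assms(1) q_fact_pos[OF assms(1), of k] by simp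
  then show "(\<lambda>n. integral\<^sup>L (Maj n q) (\<lambda>\<pi>. real (pattern_count k \<sigma> n \<pi>))) \<in> \<Theta>(\<lambda>n. real n ^ k)"
    using binomial_bigtheta[OF assms(2)]
    unfolding expectation_pattern_count[OF assms(1,3)] by simp
  have "norm (integral\<^sup>L (Maj n q) (\<lambda>\<pi>. (real (pattern_count k \<sigma> n \<pi>) -
      integral\<^sup>L (Maj n q) (\<lambda>\<pi>. real (pattern_count k \<sigma> n \<pi>)))\<^sup>2)) \<le> 1 * norm (real n ^ (2 * k - 1))" for n
    using variance_pattern_count_le[OF assms, of n] by simp
  then show "(\<lambda>n. integral\<^sup>L (Maj n q) (\<lambda>\<pi>. (real (pattern_count k \<sigma> n \<pi>) -
      integral\<^sup>L (Maj n q) (\<lambda>\<pi>. real (pattern_count k \<sigma> n \<pi>)))\<^sup>2)) \<in> O(\<lambda>n. real n ^ (2 * k - 1))"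
    by (intro bigoI[of _ 1] always_eventually) blast
qed (rule expectation_pattern_count[OF assms(1,3)])

end
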